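(* Let $k\ge 1$ be the number of available hosts that may accommodate any request flavor, i.e. $k=\min_{\vec c\in\mathbf C}k_{\vec c}$. If MaximizeParallelism$(n,\varepsilon,\mathcal B,k)$ returns $(s,d)$ with $s>1$, then employing $s$ parallel schedulers, each querying $d$ hosts, guarantees an expected decline ratio of at most $\varepsilon$.
   Context: System. There is a set $\mathbf H$ of $n$ hosts; each host $\vec h$ is a vector giving its currently available amount of each resource type. Requests are demand vectors drawn from a finite set of flavors $\mathbf C$. A host $\vec h$ is available for request $\vec r$ if $\vec h>\vec r$ coordinate-wise. $k_{\vec c}$ is the number of hosts available, at the beginning of the time slot considered, for a request of flavor $\vec c$. In a time slot, $s$ schedulers act in parallel and independently, each handling one request (of arbitrary flavor): each scheduler queries the state (at the beginning of the slot) of $d$ hosts chosen independently and uniformly at random (with replacement) from $\mathbf H$; if none of them is available for its request, the request fails; otherwise the scheduler chooses one of the (distinct) available hosts it found uniformly at random and assigns its request to it. Each host resolves the requests assigned to it in the slot sequentially in arbitrary order: a request $\vec r$ succeeds if $\vec h$ is still available for it when it is resolved, in which case the host's state is updated to $\vec h-\vec r$, and fails otherwise. The decline ratio is the fraction of the handled requests that fail. MaximizeParallelism$(n,\varepsilon,\mathcal B,k)$, for $\varepsilon\in[0,1]$ and a positive integer query budget $\mathcal B$: say that SatisfySLA$(n,\varepsilon,k,s,d)$ holds if $$k\sum_{f=1}^{s}\left[1-\left(\frac{k-1}{k}\right)^f\right]\binom{s}{f}\sigma^f(1-\sigma)^{s-f}\ \ge\ s(1-\varepsilon),\qquad \sigma=1-\left(\frac{n-k}{n}\right)^d.$$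 Start with $s=1$; while SatisfySLA$\left(n,\varepsilon,k,s+1,\left\lfloor\frac{\mathcal B}{s+1}\right\rfloor\right)$ holds, increase $s$ by 1; finally return $\left(s,\left\lfloor\frac{\mathcal B}{s}\right\rfloor\right)$. *)

theory Defs
  imports "HOL-Probability.Probability" "HOL-Library.While_Combinator"
begin

definition available :: "real ^ 'r::finite \<Rightarrow> real ^ 'r \<Rightarrow> bool" where
  "available h r \<longleftrightarrow> (\<forall>j. h $ j > r $ j)"

text \<open>Hosts are identified by elements of \<open>H\<close>, with \<open>st h\<close> the resource vector of \<open>h\<close> at the
  beginning of the slot, so that distinct hosts may have equal vectors.\<close>

definition num_available :: "'h set \<Rightarrow> ('h \<Rightarrow> real ^ 'r::finite) \<Rightarrow> real ^ 'r \<Rightarrow> nat" where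
  "num_available H st c = card {h \<in> H. available (st h) c}"

text \<open>The host chosen by one scheduler handling a request \<open>r\<close>; \<open>None\<close> if no available host was
  found. The choice is uniform on the set of available hosts found, i.e. without multiplicity.\<close>

definition scheduler_choice ::
  "'h set \<Rightarrow> ('h \<Rightarrow> real ^ 'r::finite) \<Rightarrow> nat \<Rightarrow> real ^ 'r \<Rightarrow> 'h option pmf" where
  "scheduler_choice H st d r =
     bind_pmf (replicate_pmf d (pmf_of_set H)) (\<lambda>qs.
       let F = {h \<in> set qs. available (st h) r}
       in if F = {} then return_pmf None else map_pmf Some (pmf_of_set F))"

definition assignment ::
  "'h set \<Rightarrow> ('h \<Rightarrow> real ^ 'r::finite) \<Rightarrow> nat \<Rightarrow> nat \<Rightarrow> (nat \<Rightarrow> real ^ 'r) \<Rightarrow> (nat \<Rightarrow> 'h option) pmf"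
  where
  "assignment H st s d req = Pi_pmf {..<s} None (\<lambda>i. scheduler_choice H st d (req i))"

text \<open>The set of requests that succeed when a host in state \<open>h\<close> resolves a list of requests in
  the given order.\<close>

fun resolve :: "(nat \<Rightarrow> real ^ 'r::finite) \<Rightarrow> real ^ 'r \<Rightarrow> nat list \<Rightarrow> nat set" where
  "resolve req h [] = {}"
| "resolve req h (i # is) =
     (if available h (req i) then insert i (resolve req (h - req i) is) else resolve req h is)"

text \<open>A resolution policy gives, for each assignment, a probability distribution on the orders in
  which the hosts resolve their requests; \<open>\<rho> h\<close> lists the requests assigned to \<open>h\<close>. It covers fixed
  orders (\<open>return_pmf\<close>), orders chosen in the knowledge of the whole assignment, and random
  orders.\<close>

definition resolution_policy ::
  "'h set \<Rightarrow> nat \<Rightarrow> ((nat \<Rightarrow> 'h option) \<Rightarrow> ('h \<Rightarrow> nat list) pmf) \<Rightarrow> bool" where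
  "resolution_policy H s policy \<longleftrightarrow>
     (\<forall>a. \<forall>\<rho> \<in> set_pmf (policy a). \<forall>h \<in> H.
        distinct (\<rho> h) \<and> set (\<rho> h) = {i. i < s \<and> a i = Some h})"

definition decline_ratio ::
  "('h \<Rightarrow> real ^ 'r::finite) \<Rightarrow> nat \<Rightarrow> (nat \<Rightarrow> real ^ 'r) \<Rightarrow> (nat \<Rightarrow> 'h option) \<Rightarrow> ('h \<Rightarrow> nat list) \<Rightarrow> real"
  where
  "decline_ratio st s req a \<rho> =
     real (card {i. i < s \<and>
       (case a i of None \<Rightarrow> True | Some h \<Rightarrow> i \<notin> resolve req (st h) (\<rho> h))}) / real s"

definition expected_decline_ratio ::
  "'h set \<Rightarrow> ('h \<Rightarrow> real ^ 'r::finite) \<Rightarrow> nat \<Rightarrow> nat \<Rightarrow> (nat \<Rightarrow> real ^ 'r) \<Rightarrow>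
     ((nat \<Rightarrow> 'h option) \<Rightarrow> ('h \<Rightarrow> nat list) pmf) \<Rightarrow> real" where
  "expected_decline_ratio H st s d req policy =
     measure_pmf.expectation
       (bind_pmf (assignment H st s d req) (\<lambda>a. map_pmf (\<lambda>\<rho>. (a, \<rho>)) (policy a)))
       (\<lambda>(a, \<rho>). decline_ratio st s req a \<rho>)"

definition satisfy_SLA :: "nat \<Rightarrow> real \<Rightarrow> nat \<Rightarrow> nat \<Rightarrow> nat \<Rightarrow> bool" where
  "satisfy_SLA n \<epsilon> k s d \<longleftrightarrow>
     (let \<sigma> = 1 - ((real n - real k) / real n) ^ d
      in real k * (\<Sum>f = 1..s. (1 - ((real k - 1) / real k) ^ f) * real (s choose f)
                     * \<sigma> ^ f * (1 - \<sigma>) ^ (s - f)) \<ge> real s * (1 - \<epsilon>))"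

text \<open>The result is \<open>None\<close> if the loop does not terminate (as for \<open>\<epsilon> = 1\<close> and \<open>k \<le> n\<close>).\<close>

definition maximize_parallelism :: "nat \<Rightarrow> real \<Rightarrow> nat \<Rightarrow> nat \<Rightarrow> (nat \<times> nat) option" where
  "maximize_parallelism n \<epsilon> B k =
     map_option (\<lambda>s. (s, B div s))
       (while_option (\<lambda>s. satisfy_SLA n \<epsilon> k (s + 1) (B div (s + 1))) (\<lambda>s. s + 1) 1)"

end

theory Submission
  imports Defs
begin

text \<open>
  The first request that a host resolves always succeeds, so at least as many requests succeed as
  there are hosts chosen by some scheduler. If scheduler \<open>i\<close> faces \<open>k\<^sub>i \<ge> k\<close> available hosts, then by
  symmetry it picks each of them with the same probability \<open>\<sigma>\<^sub>i / k\<^sub>i\<close>, where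
  \<open>\<sigma>\<^sub>i = 1 - (1 - k\<^sub>i / n) ^ d\<close>. Since \<open>x \<mapsto> 1 - (1 - x) ^ d\<close> is concave, \<open>\<sigma>\<^sub>i / k\<^sub>i \<le> \<sigma> / k = q\<close>,
  while the probabilities of each scheduler sum up to \<open>\<sigma>\<^sub>i \<ge> \<sigma>\<close>. By the inequality of the arithmetic
  and geometric means and concavity again, probabilities \<open>p\<^sub>i \<le> q\<close> satisfy
  \<open>1 - (\<Prod>i<s. 1 - p\<^sub>i) \<ge> (\<Sum>i<s. p\<^sub>i) / (s q) \<cdot> (1 - (1 - q) ^ s)\<close>. Summing over the hosts, the expected
  number of chosen hosts is at least \<open>k (1 - (1 - q) ^ s)\<close>, which by the binomial theorem is the
  left-hand side of the SLA condition.
\<close>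

section \<open>Concavity inequalities\<close>

text \<open>The quotient of \<open>1 - (1 - x) ^ d\<close> by \<open>x\<close> is a geometric sum in
  \<open>1 - x\<close>, hence decreasing in \<open>x\<close>. Multiplying out covers
  \<open>a = 0\<close> as well.\<close>

lemma one_minus_power_chord:
  fixes a b :: real
  assumes "0 \<le> a" "a \<le> b" "b \<le> 1"
  shows "a * (1 - (1 - b) ^ d) \<le> b * (1 - (1 - a) ^ d)"
proof -
  have eq: "1 - (1 - x) ^ d = x * (\<Sum>i<d. (1 - x) ^ i)" for x :: real
    using one_diff_power_eq[of "1 - x" d] by simp
  have "(\<Sum>i<d. (1 - b) ^ i) \<le> (\<Sum>i<d. (1 - a) ^ i)"
    using assms by (intro sum_mono power_mono) auto
  then have "(a * b) * (\<Sum>i<d. (1 - b) ^ i) \<le> (a * b) * (\<Sum>i<d. (1 - a) ^ i)"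
    using assms by (intro mult_left_mono) auto
  then show ?thesis
    by (simp add: eq mult_ac)
qed

lemma prod_le_power_arith_mean:
  fixes x :: "'a \<Rightarrow> real"
  assumes "finite S" "S \<noteq> {}" "\<And>i. i \<in> S \<Longrightarrow> x i \<ge> 0"
  shows "prod x S \<le> (sum x S / card S) ^ card S"
proof -
  have c: "card S > 0"
    using assms by (simp add: card_gt_0_iff)
  have nn: "prod x S \<ge> 0"
    using assms by (intro prod_nonneg) auto
  \<comment> \<open>\<open>powr_realpow\<close> wants a positive base; for a vanishing product both
    sides are 0 because \<open>card S > 0\<close>.\<close>
  have "prod x S = (prod x S powr (1 / card S)) ^ card S"
  proof (cases "prod x S = 0")
    case False
    then show ?thesis
      using nn c by (simp add: powr_realpow[symmetric] powr_powr)
  qed (use c in simp)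
  also have "\<dots> \<le> (\<Sum>i\<in>S. x i / card S) ^ card S"
    using arith_geom_mean[OF assms] by (intro power_mono) auto
  finally show ?thesis
    by (simp add: sum_divide_distrib)
qed

text \<open>Replacing every \<open>p i\<close> by the mean \<open>m\<close> can only enlarge the
  product, and the chord inequality then compares \<open>m\<close> with \<open>q\<close>. The form
  without quotients keeps \<open>q = 0\<close> and empty \<open>S\<close> included.\<close>

lemma one_minus_prod_ge:
  fixes p :: "'a \<Rightarrow> real" and q :: real
  assumes "finite S" and p: "\<And>i. i \<in> S \<Longrightarrow> 0 \<le> p i \<and> p i \<le> q" and "q \<le> 1"
  shows "sum p S * (1 - (1 - q) ^ card S) \<le> card S * q * (1 - (\<Prod>i\<in>S. 1 - p i))"
proof (cases "S = {}")
  case False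
  define c where "c = real (card S)"
  define m where "m = sum p S / c"
  have c: "c > 0"
    using assms(1) False by (simp add: c_def card_gt_0_iff)
  obtain i where "i \<in> S"
    using False by blast
  then have q: "0 \<le> q"
    using p[of i] by simp
  have "sum p S \<le> c * q"
    using sum_bounded_above[of S p q] p by (simp add: c_def)
  then have m: "0 \<le> m" "m \<le> q"
    using c p by (auto simp: m_def divide_le_eq mult.commute intro!: divide_nonneg_nonneg sum_nonneg)
  have "(\<Prod>i\<in>S. 1 - p i) \<le> ((\<Sum>i\<in>S. 1 - p i) / c) ^ card S"
    unfolding c_def
  proof (rule prod_le_power_arith_mean)
    show "1 - p i \<ge> 0" if "i \<in> S" for i
      using p[OF that] \<open>q \<le> 1\<close> by linarith
  qed (use assms False in auto)
  also have "(\<Sum>i\<in>S. 1 - p i) / c = 1 - m"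
    using c by (simp add: m_def sum_subtractf c_def diff_divide_distrib)
  finally have prod: "(\<Prod>i\<in>S. 1 - p i) \<le> (1 - m) ^ card S" .
  have "m * (1 - (1 - q) ^ card S) \<le> q * (1 - (1 - m) ^ card S)"
    using m assms(3) by (rule one_minus_power_chord)
  also have "\<dots> \<le> q * (1 - (\<Prod>i\<in>S. 1 - p i))"
    using prod q by (intro mult_left_mono) auto
  finally have "c * (m * (1 - (1 - q) ^ card S)) \<le> c * (q * (1 - (\<Prod>i\<in>S. 1 - p i)))"
    using c by (intro mult_left_mono) auto
  moreover have "c * m = sum p S"
    using c by (simp add: m_def)
  ultimately show ?thesis
    by (simp add: c_def mult.assoc[symmetric])
qed simp

section \<open>The choice of a single scheduler\<close>

text \<open>Each independent draw contributes one factor. The induction uses nonnegative integrals,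
  which need no integrability, and passes to real numbers only at the end.\<close>

lemma prob_replicate_pmf_disjoint:
  "measure_pmf.prob (replicate_pmf d p) {xs. set xs \<inter> A = {}} = measure_pmf.prob p (- A) ^ d"
proof -
  have "emeasure (replicate_pmf d p) {xs. set xs \<inter> A = {}} = emeasure p (- A) ^ d"
  proof (induction d)
    case (Suc d)
    let ?R = "replicate_pmf d p"
    have "emeasure (replicate_pmf (Suc d) p) {xs. set xs \<inter> A = {}} =
        (\<integral>\<^sup>+xs. indicator {xs. set xs \<inter> A = {}} xs \<partial>replicate_pmf (Suc d) p)"
      by simp
    also have "\<dots> = (\<integral>\<^sup>+x. \<integral>\<^sup>+xs. indicator {xs. set xs \<inter> A = {}} (x # xs) \<partial>?R \<partial>p)"
      by (simp del: nn_integral_indicator)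
    also have "\<dots> = (\<integral>\<^sup>+x. \<integral>\<^sup>+xs. indicator (- A) x * indicator {xs. set xs \<inter> A = {}} xs \<partial>?R \<partial>p)"
      by (intro nn_integral_cong) (auto simp: indicator_def)
    also have "\<dots> = (\<integral>\<^sup>+x. indicator (- A) x * emeasure ?R {xs. set xs \<inter> A = {}} \<partial>p)"
      by (simp add: nn_integral_cmult)
    also have "\<dots> = emeasure p (- A) * emeasure ?R {xs. set xs \<inter> A = {}}"
      by (simp add: nn_integral_multc)
    finally show ?case
      by (simp add: Suc)
  qed simp
  then show ?thesis
    by (simp add: measure_pmf.emeasure_eq_measure ennreal_power)
qed

text \<open>Carries the invariance of the uniform distribution under a swap of two hosts over to
  lists of queries.\<close>

lemma map_pmf_replicate_pmf:
  "map_pmf (map f) (replicate_pmf d p) = replicate_pmf d (map_pmf f p)"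
proof (induction d)
  case (Suc d)
  show ?case
    by (simp add: Suc[symmetric] map_bind_pmf bind_map_pmf)
qed simp

context
  fixes H :: "'h set" and st :: "'h \<Rightarrow> real ^ 'r::finite" and r :: "real ^ 'r" and d :: nat
  assumes fin: "finite H" and ne: "H \<noteq> {}"
begin

lemma set_pmf_scheduler_choice:
  "set_pmf (scheduler_choice H st d r) \<subseteq> insert None (Some ` {h \<in> H. available (st h) r})"
  using fin ne
  by (auto simp: scheduler_choice_def Let_def set_replicate_pmf in_lists_conv_set split: if_splits)

lemma pmf_scheduler_choice_None:
  "pmf (scheduler_choice H st d r) None = (1 - num_available H st r / card H) ^ d"
proof -
  let ?A = "{h \<in> H. available (st h) r}"
  \<comment> \<open>Given the queries, \<open>None\<close> has mass 1 or 0, according to whether all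
    of them miss the available hosts.\<close>
  have "pmf (scheduler_choice H st d r) None =
    measure_pmf.expectation (replicate_pmf d (pmf_of_set H))
      (indicator {qs. set qs \<inter> {h. available (st h) r} = {}})"
    unfolding scheduler_choice_def Let_def pmf_bind
    by (intro integral_cong_AE AE_pmfI)
      (auto simp: indicator_def pmf_eq_0_set_pmf)
  also have "\<dots> = measure_pmf.prob (pmf_of_set H) (- {h. available (st h) r}) ^ d"
    by (simp add: prob_replicate_pmf_disjoint)
  also have "measure_pmf.prob (pmf_of_set H) (- {h. available (st h) r}) =
      1 - measure_pmf.prob (pmf_of_set H) {h. available (st h) r}"
    by (subst measure_pmf.prob_compl[symmetric]) (auto simp: Compl_eq_Diff_UNIV)
  also have "measure_pmf.prob (pmf_of_set H) {h. available (st h) r} =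
      num_available H st r / card H"
    using fin ne by (simp add: measure_pmf_of_set num_available_def Collect_conj_eq)
  finally show ?thesis .
qed

text \<open>Exchanging two available hosts leaves the distribution of the queried hosts invariant.\<close>

lemma pmf_scheduler_choice_symmetric:
  assumes "x \<in> H" "available (st x) r" "y \<in> H" "available (st y) r"
  shows "pmf (scheduler_choice H st d r) (Some x) = pmf (scheduler_choice H st d r) (Some y)"
proof -
  let ?t = "Transposition.transpose x y"
  let ?R = "replicate_pmf d (pmf_of_set H)"
  define F where "F qs = {h \<in> set qs. available (st h) r}" for qs
  define K where "K qs = (if F qs = {} then return_pmf None else map_pmf Some (pmf_of_set (F qs)))"
    for qs
  have sched: "scheduler_choice H st d r = bind_pmf ?R K"
    unfolding scheduler_choice_def K_def[abs_def] F_def Let_def ..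
  have finF: "finite (F qs)" for qs
    by (simp add: F_def)
  have K: "pmf (K qs) (Some h) = (if h \<in> F qs then 1 / card (F qs) else 0)" for qs h
    using finF by (auto simp: K_def pmf_map_inj')
  \<comment> \<open>Since \<open>x\<close> and \<open>y\<close> are both available, the swap
    preserves availability.\<close>
  have F: "F (map ?t qs) = ?t ` F qs" for qs
  proof -
    have "available (st (?t h)) r \<longleftrightarrow> available (st h) r" for h
      using assms by (simp add: Transposition.transpose_def)
    then show ?thesis
      by (auto simp: F_def)
  qed
  have "?t ` H = H"
    using assms by simp
  then have "map_pmf ?t (pmf_of_set H) = pmf_of_set H"
    using fin ne by (simp add: map_pmf_of_set_inj)
  then have R: "map_pmf (map ?t) ?R = ?R"
    by (simp add: map_pmf_replicate_pmf)
  \<comment> \<open>The invariance \<open>R\<close> is used backwards: the swap enters the query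
    distribution and is then moved into the integrand, where it turns \<open>y\<close> into
    \<open>x\<close>.\<close>
  have "pmf (scheduler_choice H st d r) (Some y) =
      measure_pmf.expectation (map_pmf (map ?t) ?R) (\<lambda>qs. pmf (K qs) (Some y))"
    by (simp only: sched pmf_bind R)
  also have "\<dots> = measure_pmf.expectation ?R (\<lambda>qs. pmf (K (map ?t qs)) (Some y))"
    by simp
  also have "\<dots> = measure_pmf.expectation ?R (\<lambda>qs. pmf (K qs) (Some x))"
  proof (rule Bochner_Integration.integral_cong)
    fix qs
    have "y \<in> ?t ` F qs \<longleftrightarrow> x \<in> F qs"
      by (metis inj_image_mem_iff inj_transpose transpose_apply_first)
    then show "pmf (K (map ?t qs)) (Some y) = pmf (K qs) (Some x)"
      by (simp add: K F card_image)
  qed simp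
  finally show ?thesis
    by (simp add: sched pmf_bind)
qed

lemma sum_pmf_scheduler_choice:
  "(\<Sum>h\<in>H. pmf (scheduler_choice H st d r) (Some h)) =
     1 - (1 - num_available H st r / card H) ^ d"
proof -
  have "(\<Sum>z\<in>insert None (Some ` H). pmf (scheduler_choice H st d r) z) = 1"
    using fin set_pmf_scheduler_choice by (intro sum_pmf_eq_1) auto
  then show ?thesis
    using fin by (simp add: sum.reindex pmf_scheduler_choice_None)
qed

text \<open>All available hosts share one probability by symmetry and the others have probability 0,
  so the total mass is a multiple of it.\<close>

lemma pmf_scheduler_choice_Some_available:
  assumes "h \<in> H" "available (st h) r"
  shows "num_available H st r * pmf (scheduler_choice H st d r) (Some h) =
     1 - (1 - num_available H st r / card H) ^ d"
proof -
  let ?A = "{h \<in> H. available (st h) r}"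
  have "(\<Sum>x\<in>H. pmf (scheduler_choice H st d r) (Some x)) =
      (\<Sum>x\<in>?A. pmf (scheduler_choice H st d r) (Some x))"
    using fin set_pmf_scheduler_choice
    by (intro sum.mono_neutral_right) (auto simp: pmf_eq_0_set_pmf)
  also have "\<dots> = (\<Sum>x\<in>?A. pmf (scheduler_choice H st d r) (Some h))"
    using assms by (intro sum.cong pmf_scheduler_choice_symmetric) auto
  finally show ?thesis
    by (simp add: sum_pmf_scheduler_choice num_available_def)
qed

text \<open>For an available host this is the chord inequality between \<open>k / n\<close> and
  \<open>m / n\<close>. Any other host has mass 0, and the bound is nonnegative because
  \<open>k \<le> card H\<close>.\<close>

lemma pmf_scheduler_choice_Some_le:
  assumes "1 \<le> k" "k \<le> num_available H st r"
  shows "pmf (scheduler_choice H st d r) (Some h) \<le> (1 - (1 - real k / card H) ^ d) / k"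
proof (cases "h \<in> H \<and> available (st h) r")
  case True
  define m where "m = num_available H st r"
  define n where "n = card H"
  define \<pi> where "\<pi> = pmf (scheduler_choice H st d r) (Some h)"
  have n: "n > 0"
    using fin ne by (simp add: n_def card_gt_0_iff)
  have "m \<le> n"
    unfolding m_def n_def num_available_def by (intro card_mono fin) auto
  then have "k / n * (1 - (1 - m / n) ^ d) \<le> m / n * (1 - (1 - k / n) ^ d)"
    using assms n by (intro one_minus_power_chord) (auto simp: divide_right_mono m_def)
  then have "k / n * (m * \<pi>) \<le> m / n * (1 - (1 - k / n) ^ d)"
    using True by (simp add: pmf_scheduler_choice_Some_available m_def n_def \<pi>_def)
  then have "(m / n) * (k * \<pi>) \<le> (m / n) * (1 - (1 - k / n) ^ d)"
    by (simp add: mult_ac)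
  moreover have "real m / n > 0"
    using assms n by (simp add: m_def)
  ultimately have "k * \<pi> \<le> 1 - (1 - k / n) ^ d"
    by (metis mult_le_cancel_left_pos)
  then show ?thesis
    using assms by (simp add: pos_le_divide_eq \<pi>_def n_def mult.commute)
next
  case False
  then have "pmf (scheduler_choice H st d r) (Some h) = 0"
    using set_pmf_scheduler_choice by (auto simp: pmf_eq_0_set_pmf)
  moreover have "k \<le> card H"
    using assms(2) card_mono[OF fin, of "{h \<in> H. available (st h) r}"]
    by (auto simp: num_available_def)
  then have "(1 - real k / card H) ^ d \<le> 1"
    by (intro power_le_one) (auto simp: divide_le_eq)
  ultimately show ?thesis
    by simp
qed

end

section \<open>Declined requests and chosen hosts\<close>

lemma resolve_hd: "is \<noteq> [] \<Longrightarrow> available h (req (hd is)) \<Longrightarrow> hd is \<in> resolve req h is"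
  by (cases "is") auto

text \<open>The first request in the list of a chosen host meets the host in its initial state, for
  which it is available, and so succeeds.\<close>

lemma decline_ratio_le:
  assumes fin: "finite H" and s: "s > 0"
    and \<rho>: "\<And>h. h \<in> H \<Longrightarrow> set (\<rho> h) = {i. i < s \<and> a i = Some h}"
    and a: "\<And>i h. i < s \<Longrightarrow> a i = Some h \<Longrightarrow> available (st h) (req i)"
  shows "decline_ratio st s req a \<rho> \<le> 1 - card {h \<in> H. \<exists>i<s. a i = Some h} / s"
proof -
  let ?O = "{h \<in> H. \<exists>i<s. a i = Some h}"
  let ?D = "{i. i < s \<and> (case a i of None \<Rightarrow> True | Some h \<Rightarrow> i \<notin> resolve req (st h) (\<rho> h))}"
  have hd: "hd (\<rho> h) < s \<and> a (hd (\<rho> h)) = Some h \<and> hd (\<rho> h) \<in> resolve req (st h) (\<rho> h)"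
    if "h \<in> ?O" for h
  proof -
    have "set (\<rho> h) \<noteq> {}"
      using \<rho>[of h] that by auto
    then have "\<rho> h \<noteq> []"
      by simp
    then have "hd (\<rho> h) < s" "a (hd (\<rho> h)) = Some h"
      using \<rho>[of h] that hd_in_set by auto
    with \<open>\<rho> h \<noteq> []\<close> show ?thesis
      using a resolve_hd by blast
  qed
  \<comment> \<open>Distinct hosts have distinct first requests, since \<open>a\<close> recovers the
    host from the request.\<close>
  have "card ?O = card ((\<lambda>h. hd (\<rho> h)) ` ?O)"
    using hd by (intro card_image[symmetric] inj_onI) (metis option.inject)
  also have "\<dots> \<le> card ({..<s} - ?D)"
  proof (intro card_mono subsetI)
    fix i assume "i \<in> (\<lambda>h. hd (\<rho> h)) ` ?O"
    then obtain h where "h \<in> ?O" "i = hd (\<rho> h)"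
      by blast
    then have "i < s" "a i = Some h" "i \<in> resolve req (st h) (\<rho> h)"
      using hd by blast+
    then show "i \<in> {..<s} - ?D"
      by simp
  qed simp
  also have "\<dots> = s - card ?D"
    by (subst card_Diff_subset) auto
  finally have "card ?O \<le> s - card ?D" .
  moreover have "card ?D \<le> card {..<s}"
    by (intro card_mono) auto
  ultimately have "real (card ?D) \<le> real s - card ?O"
    by simp
  then have "real (card ?D) / s \<le> (real s - card ?O) / s"
    by (intro divide_right_mono) auto
  then show ?thesis
    using s by (simp add: decline_ratio_def diff_divide_distrib)
qed

text \<open>Linearity of expectation reduces the count to single hosts; by independence, the
  probability that every scheduler avoids \<open>h\<close> is a product.\<close>

lemma expectation_chosen_hosts:
  fixes H :: "'h set"
  assumes "finite H"
  shows "measure_pmf.expectation (assignment H st s d req)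
       (\<lambda>a. real (card {h \<in> H. \<exists>i<s. a i = Some h})) =
     (\<Sum>h\<in>H. 1 - (\<Prod>i<s. 1 - pmf (scheduler_choice H st d (req i)) (Some h)))"
proof -
  let ?P = "assignment H st s d req"
  have "real (card {h \<in> H. \<exists>i<s. a i = Some h}) =
      (\<Sum>h\<in>H. indicator {a. \<exists>i<s. a i = Some h} a)" for a :: "nat \<Rightarrow> 'h option"
    using assms by (simp add: indicator_def sum.If_cases Int_def)
  then have "measure_pmf.expectation ?P (\<lambda>a. real (card {h \<in> H. \<exists>i<s. a i = Some h})) =
      (\<Sum>h\<in>H. measure_pmf.prob ?P {a. \<exists>i<s. a i = Some h})"
    by (simp add: integrable_real_indicator measure_pmf.emeasure_eq_measure)
  also have "\<dots> = (\<Sum>h\<in>H. 1 - (\<Prod>i<s. 1 - pmf (scheduler_choice H st d (req i)) (Some h)))"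
  proof (rule sum.cong)
    fix h :: 'h
    have compl: "measure_pmf.prob p (- {Some h}) = 1 - pmf p (Some h)" for p
      using measure_pmf.prob_compl[of "{Some h}" p]
      by (simp add: Compl_eq_Diff_UNIV measure_pmf_single)
    have "{a. \<exists>i<s. a i = Some h} = UNIV - Pi {..<s} (\<lambda>_. - {Some h})"
      by (auto simp: Pi_def)
    then have "measure_pmf.prob ?P {a. \<exists>i<s. a i = Some h} =
        1 - measure_pmf.prob ?P (Pi {..<s} (\<lambda>_. - {Some h}))"
      using measure_pmf.prob_compl[of _ ?P] by simp
    also have "measure_pmf.prob ?P (Pi {..<s} (\<lambda>_. - {Some h})) =
        (\<Prod>i<s. measure_pmf.prob (scheduler_choice H st d (req i)) (- {Some h}))"
      by (simp add: assignment_def measure_Pi_pmf_Pi)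
    also have "\<dots> = (\<Prod>i<s. 1 - pmf (scheduler_choice H st d (req i)) (Some h))"
      by (simp only: compl)
    finally show "measure_pmf.prob ?P {a. \<exists>i<s. a i = Some h} =
        1 - (\<Prod>i<s. 1 - pmf (scheduler_choice H st d (req i)) (Some h))" .
  qed simp
  finally show ?thesis .
qed

text \<open>The pointwise bound does not depend on the order \<open>\<rho>\<close>, so only the
  marginal distribution of the assignment enters.\<close>

lemma expected_decline_ratio_le:
  assumes fin: "finite H" and ne: "H \<noteq> {}" and s: "s > 0" and pol: "resolution_policy H s policy"
  shows "expected_decline_ratio H st s d req policy \<le>
     1 - (\<Sum>h\<in>H. 1 - (\<Prod>i<s. 1 - pmf (scheduler_choice H st d (req i)) (Some h))) / s"
proof -
  let ?P = "assignment H st s d req"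
  let ?Q = "bind_pmf ?P (\<lambda>a. map_pmf (\<lambda>\<rho>. (a, \<rho>)) (policy a))"
  define N where "N a = real (card {h \<in> H. \<exists>i<s. a i = Some h})" for a :: "nat \<Rightarrow> 'a option"
  have N: "0 \<le> N a" "N a \<le> card H" for a
    unfolding N_def using fin by (auto intro!: card_mono)
  have fst: "map_pmf fst ?Q = ?P"
    by (simp add: map_bind_pmf pmf.map_comp o_def bind_return_pmf')
  have D: "0 \<le> decline_ratio st s req a \<rho>" "decline_ratio st s req a \<rho> \<le> 1" for a \<rho>
  proof -
    let ?D = "{i. i < s \<and> (case a i of None \<Rightarrow> True | Some h \<Rightarrow> i \<notin> resolve req (st h) (\<rho> h))}"
    have "card ?D \<le> card {..<s}"
      by (intro card_mono) auto
    then show "decline_ratio st s req a \<rho> \<le> 1"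
      using s by (simp add: decline_ratio_def)
  qed (simp add: decline_ratio_def)
  \<comment> \<open>The support of \<open>policy a\<close> may be infinite, as \<open>\<rho>\<close>
    is unconstrained outside \<open>H\<close>; integrability therefore comes from
    boundedness.\<close>
  have intN: "integrable ?Q (\<lambda>(a, \<rho>). 1 - N a / s)"
  proof (intro measure_pmf.integrable_const_bound[where B = "1 + card H / s"] AE_pmfI)
    have "\<bar>1 - N a / s\<bar> \<le> 1 + card H / s" for a
      using divide_right_mono[OF N(1), of s a] divide_right_mono[OF N(2), of s a] by simp
    then show "norm (case x of (a, \<rho>) \<Rightarrow> 1 - N a / s) \<le> 1 + card H / s" for x
      by (cases x) simp
  qed simp
  have "expected_decline_ratio H st s d req policy \<le>
      measure_pmf.expectation ?Q (\<lambda>(a, \<rho>). 1 - N a / s)"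
    unfolding expected_decline_ratio_def
  proof (rule integral_mono_AE)
    show "integrable ?Q (\<lambda>(a, \<rho>). decline_ratio st s req a \<rho>)"
      using D by (intro measure_pmf.integrable_const_bound[where B = 1] AE_pmfI) auto
    show "AE x in ?Q. (case x of (a, \<rho>) \<Rightarrow> decline_ratio st s req a \<rho>) \<le>
        (case x of (a, \<rho>) \<Rightarrow> 1 - N a / s)"
    proof (rule AE_pmfI)
      fix x assume "x \<in> set_pmf ?Q"
      then obtain a \<rho> where x: "x = (a, \<rho>)" and a: "a \<in> set_pmf ?P" and \<rho>: "\<rho> \<in> set_pmf (policy a)"
        by auto
      \<comment> \<open>This holds only on the support of the assignment, hence the comparison
        almost everywhere.\<close>
      have "available (st h) (req i)" if "i < s" "a i = Some h" for i h
      proof -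
        have "a i \<in> set_pmf (scheduler_choice H st d (req i))"
          using a that(1) by (auto simp: assignment_def set_Pi_pmf PiE_dflt_def)
        then show ?thesis
          using set_pmf_scheduler_choice[OF fin ne] that(2) by fastforce
      qed
      then have "decline_ratio st s req a \<rho> \<le> 1 - N a / s"
        unfolding N_def using pol \<rho>
        by (intro decline_ratio_le fin s) (auto simp: resolution_policy_def)
      then show "(case x of (a, \<rho>) \<Rightarrow> decline_ratio st s req a \<rho>) \<le>
          (case x of (a, \<rho>) \<Rightarrow> 1 - N a / s)"
        by (simp add: x)
    qed
  qed (fact intN)
  also have "\<dots> = measure_pmf.expectation (map_pmf fst ?Q) (\<lambda>a. 1 - N a / s)"
    unfolding integral_map_pmf by (simp only: case_prod_unfold)
  also have "\<dots> = measure_pmf.expectation ?P (\<lambda>a. 1 - N a / s)"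
    by (simp only: fst)
  also have "\<dots> = 1 - measure_pmf.expectation ?P N / s"
  proof -
    have "integrable ?P N"
      using N by (intro measure_pmf.integrable_const_bound[where B = "card H"] AE_pmfI) auto
    then show ?thesis
      by simp
  qed
  finally show ?thesis
    unfolding N_def expectation_chosen_hosts[OF fin] .
qed

section \<open>The SLA condition\<close>

text \<open>With \<open>f\<close> the number of schedulers that find a host, the sum is the
  probability that a fixed one of \<open>k\<close> hosts is picked when each success is uniform on
  them. Each scheduler thus picks it with probability \<open>\<sigma> / k\<close>.\<close>

lemma satisfy_SLA_iff:
  assumes "k > 0" "n > 0"
  shows "satisfy_SLA n \<epsilon> k s d \<longleftrightarrow>
     real s * (1 - \<epsilon>) \<le> k * (1 - (1 - (1 - (1 - real k / n) ^ d) / k) ^ s)"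
proof -
  define \<sigma> where "\<sigma> = 1 - (1 - real k / n) ^ d"
  define c where "c = (real k - 1) / k"
  \<comment> \<open>The term for \<open>f = 0\<close> vanishes because \<open>c ^ 0 = 1\<close>, so
    the binomial theorem applies to the full range.\<close>
  have "(\<Sum>f = 1..s. (1 - c ^ f) * real (s choose f) * \<sigma> ^ f * (1 - \<sigma>) ^ (s - f)) =
      (\<Sum>f\<le>s. (1 - c ^ f) * real (s choose f) * \<sigma> ^ f * (1 - \<sigma>) ^ (s - f))"
    by (intro sum.mono_neutral_left) (auto simp: not_le)
  also have "\<dots> = (\<Sum>f\<le>s. real (s choose f) * \<sigma> ^ f * (1 - \<sigma>) ^ (s - f)) -
      (\<Sum>f\<le>s. real (s choose f) * (c * \<sigma>) ^ f * (1 - \<sigma>) ^ (s - f))"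
    by (simp add: sum_subtractf[symmetric] algebra_simps power_mult_distrib)
  also have "\<dots> = (\<sigma> + (1 - \<sigma>)) ^ s - (c * \<sigma> + (1 - \<sigma>)) ^ s"
    by (simp only: binomial_ring)
  also have "c * \<sigma> + (1 - \<sigma>) = 1 - \<sigma> / k"
    using assms by (simp add: c_def field_simps)
  finally have "(\<Sum>f = 1..s. (1 - c ^ f) * real (s choose f) * \<sigma> ^ f * (1 - \<sigma>) ^ (s - f)) =
      1 - (1 - \<sigma> / k) ^ s"
    by simp
  moreover have "(real n - real k) / n = 1 - real k / n"
    using assms by (simp add: diff_divide_distrib)
  ultimately show ?thesis
    by (simp add: satisfy_SLA_def Let_def \<sigma>_def c_def)
qed

text \<open>The guard tests the successor, so each increment establishes the condition for the new
  value. The initial value 1 is never tested, hence the disjunct \<open>s = 1\<close> in the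
  invariant.\<close>

lemma maximize_parallelism_satisfies_SLA:
  assumes "maximize_parallelism n \<epsilon> B k = Some (s, d)" "s > 1"
  shows "satisfy_SLA n \<epsilon> k s d"
proof -
  have w: "while_option (\<lambda>s. satisfy_SLA n \<epsilon> k (s + 1) (B div (s + 1))) (\<lambda>s. s + 1) 1 = Some s"
    and d: "d = B div s"
    using assms(1) by (auto simp: maximize_parallelism_def)
  have "s = 1 \<or> satisfy_SLA n \<epsilon> k s (B div s)"
    by (rule while_option_rule[OF _ w, where P = "\<lambda>s. s = 1 \<or> satisfy_SLA n \<epsilon> k s (B div s)"]) auto
  then show ?thesis
    using assms(2) d by simp
qed

lemma sum_one_minus_prod_scheduler_choice_ge:
  assumes fin: "finite H" and k: "1 \<le> k" and s: "s > 0"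
    and avail: "\<And>i. i < s \<Longrightarrow> k \<le> num_available H st (req i)"
  shows "k * (1 - (1 - (1 - (1 - real k / card H) ^ d) / k) ^ s) \<le>
     (\<Sum>h\<in>H. 1 - (\<Prod>i<s. 1 - pmf (scheduler_choice H st d (req i)) (Some h)))"
proof -
  define n where "n = real (card H)"
  define p where "p i h = pmf (scheduler_choice H st d (req i)) (Some h)" for i h
  define \<sigma> where "\<sigma> = 1 - (1 - real k / n) ^ d"
  define q where "q = \<sigma> / k"
  define \<phi> where "\<phi> = 1 - (1 - q) ^ s"
  define S where "S = (\<Sum>h\<in>H. 1 - (\<Prod>i<s. 1 - p i h))"
  have num_le: "num_available H st r \<le> card H" for r
    unfolding num_available_def by (intro card_mono fin) auto
  have kn: "k \<le> card H"
    using avail[OF s] num_le order_trans by blast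
  then have ne: "H \<noteq> {}" and n: "n > 0"
    using k by (auto simp: n_def)
  have "real k / n \<le> 1"
    using kn n by (simp add: n_def)
  then have \<sigma>: "0 \<le> \<sigma>" "\<sigma> \<le> 1"
    using n by (auto simp: \<sigma>_def intro!: power_le_one)
  then have q: "0 \<le> q" "q \<le> 1"
    using k by (auto simp: q_def divide_le_eq)
  then have \<phi>: "0 \<le> \<phi>"
    by (auto simp: \<phi>_def intro!: power_le_one)
  have p: "0 \<le> p i h \<and> p i h \<le> q" if "i < s" for i h
    using pmf_scheduler_choice_Some_le[OF fin ne k avail[OF that]]
    by (simp add: p_def q_def \<sigma>_def n_def)
  have sum_p: "\<sigma> \<le> (\<Sum>h\<in>H. p i h)" if "i < s" for i
  proof -
    have "(1 - num_available H st (req i) / n) ^ d \<le> (1 - k / n) ^ d"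
      using avail[OF that] num_le[of "req i"] n
      by (intro power_mono) (auto simp: divide_right_mono n_def)
    then show ?thesis
      by (simp add: p_def sum_pmf_scheduler_choice[OF fin ne] \<sigma>_def n_def)
  qed
  have "s * \<sigma> \<le> (\<Sum>i<s. \<Sum>h\<in>H. p i h)"
    using sum_bounded_below[of "{..<s}" \<sigma> "\<lambda>i. \<Sum>h\<in>H. p i h"] sum_p by simp
  also have "\<dots> = (\<Sum>h\<in>H. \<Sum>i<s. p i h)"
    by (rule sum.swap)
  finally have "s * \<sigma> * \<phi> \<le> (\<Sum>h\<in>H. \<Sum>i<s. p i h) * \<phi>"
    using \<phi> by (rule mult_right_mono)
  also have "\<dots> = (\<Sum>h\<in>H. (\<Sum>i<s. p i h) * \<phi>)"
    by (rule sum_distrib_right)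
  \<comment> \<open>For each host, \<open>one_minus_prod_ge\<close> is applied with the schedulers
    as index set.\<close>
  also have "\<dots> \<le> (\<Sum>h\<in>H. s * q * (1 - (\<Prod>i<s. 1 - p i h)))"
    using one_minus_prod_ge[of "{..<s}" "\<lambda>i. p i _" q] p q
    by (intro sum_mono) (simp add: \<phi>_def)
  also have "\<dots> = s * q * S"
    by (simp add: S_def sum_distrib_left)
  finally have le: "(s * q) * (k * \<phi>) \<le> (s * q) * S"
    using k by (simp add: q_def mult_ac)
  \<comment> \<open>The factor \<open>s * q\<close> cannot be cancelled if \<open>q = 0\<close>,
    which happens for \<open>d = 0\<close>; then both sides are 0.\<close>
  have "k * \<phi> \<le> S"
  proof (cases "q = 0")
    case True
    then have "p i h = 0" if "i < s" for i h
      using p[OF that, of h] by simp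
    then show ?thesis
      using True by (simp add: \<phi>_def S_def)
  next
    case False
    then have "s * q > 0"
      using q s by simp
    then show ?thesis
      using le by (metis mult_le_cancel_left_pos)
  qed
  then show ?thesis
    by (simp add: \<phi>_def S_def q_def \<sigma>_def n_def p_def)
qed

theorem theorem26:
  fixes H :: "'h set" and st :: "'h \<Rightarrow> real ^ 'r::finite" and C :: "(real ^ 'r) set"
    and n k B s d :: nat and \<epsilon> :: real
    and req :: "nat \<Rightarrow> real ^ 'r"
    and policy :: "(nat \<Rightarrow> 'h option) \<Rightarrow> ('h \<Rightarrow> nat list) pmf"
  assumes "finite H" and "card H = n"
    and "finite C" and "C \<noteq> {}"
    and "k = Min (num_available H st ` C)" and "k \<ge> 1"
    and "0 \<le> \<epsilon>" and "\<epsilon> \<le> 1" and "B > 0"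
    and "maximize_parallelism n \<epsilon> B k = Some (s, d)" and "s > 1"
    and "\<And>i. i < s \<Longrightarrow> req i \<in> C"
    and "resolution_policy H s policy"
  shows "expected_decline_ratio H st s d req policy \<le> \<epsilon>"
proof -
  let ?S = "\<Sum>h\<in>H. 1 - (\<Prod>i<s. 1 - pmf (scheduler_choice H st d (req i)) (Some h))"
  have avail: "k \<le> num_available H st (req i)" if "i < s" for i
    using assms(3,5) assms(12)[OF that] by simp
  have s: "s > 0"
    using assms(11) by simp
  \<comment> \<open>An available host for the first request shows that \<open>H\<close> is
    nonempty.\<close>
  have "num_available H st (req 0) \<noteq> 0"
    using avail[OF s] assms(6) by simp
  then have ne: "H \<noteq> {}"
    by (auto simp: num_available_def)
  then have n: "n > 0"
    unfolding assms(2)[symmetric] using assms(1) by (simp add: card_gt_0_iff)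
  have k: "k > 0"
    using assms(6) by linarith
  have "s * (1 - \<epsilon>) \<le> k * (1 - (1 - (1 - (1 - real k / n) ^ d) / k) ^ s)"
    using maximize_parallelism_satisfies_SLA[OF assms(10,11)] satisfy_SLA_iff[OF k n] by blast
  also have "\<dots> \<le> ?S"
    using sum_one_minus_prod_scheduler_choice_ge[OF assms(1,6) s avail] unfolding assms(2) .
  finally have "1 - \<epsilon> \<le> ?S / s"
    using s by (simp add: pos_le_divide_eq mult.commute)
  then show ?thesis
    using expected_decline_ratio_le[OF assms(1) ne s assms(13), of st d req] by linarith
qed

end
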